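(* Let $n\ge1$ and $\lambda\ge2$ be integers, and let $\tau$ be a rational trigonometric polynomial on $\mathbb{T}^n$ satisfying $\tau(0)=1$. Then $$\lim_{\xi\to0}\prod_{j=1}^\infty\tau(\lambda^{-j}\xi)=1.$$
   Context: A trigonometric polynomial on $\mathbb{T}^n=\mathbb{R}^n/(2\pi\mathbb{Z})^n$ is a finite sum $\sum_{k\in\mathbb{Z}^n}h(k)e^{-ik\cdot\xi}$ with complex coefficients. A rational trigonometric polynomial is a quotient $\tau_1/\tau_2$ of trigonometric polynomials with $\tau_2\not\equiv0$ and with the greatest common divisor of $\tau_1$ and $\tau_2$ constant; the condition $\tau(0)=1$ includes that $\tau$ is defined at $0$, i.e. $\tau_2(0)\neq0$. *)

theory Defs
  imports "HOL-Analysis.Analysis"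
begin

text \<open>
  Functions on the torus are represented by their periodic lifts to \<open>real ^ 'n\<close>;
  the dimension is \<open>CARD('n) \<ge> 1\<close>.
\<close>

definition trig_poly :: "(real ^ 'n \<Rightarrow> complex) \<Rightarrow> bool" where
  "trig_poly f \<longleftrightarrow>
     (\<exists>(K :: (int ^ 'n) set) (h :: int ^ 'n \<Rightarrow> complex). finite K \<and>
       (\<forall>\<xi>. f \<xi> = (\<Sum>k\<in>K. h k * exp (- (\<i> * of_real ((\<chi> i. real_of_int (k $ i)) \<bullet> \<xi>))))))"

text \<open>Divisibility and greatest common divisors are taken in the ring of trigonometric polynomials.\<close>

definition trig_dvd :: "(real ^ 'n \<Rightarrow> complex) \<Rightarrow> (real ^ 'n \<Rightarrow> complex) \<Rightarrow> bool" where
  "trig_dvd d f \<longleftrightarrow> (\<exists>q. trig_poly q \<and> (\<forall>\<xi>. f \<xi> = d \<xi> * q \<xi>))"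

definition is_trig_gcd ::
  "(real ^ 'n \<Rightarrow> complex) \<Rightarrow> (real ^ 'n \<Rightarrow> complex) \<Rightarrow> (real ^ 'n \<Rightarrow> complex) \<Rightarrow> bool" where
  "is_trig_gcd g f1 f2 \<longleftrightarrow> trig_poly g \<and> trig_dvd g f1 \<and> trig_dvd g f2 \<and>
     (\<forall>d. trig_poly d \<longrightarrow> trig_dvd d f1 \<longrightarrow> trig_dvd d f2 \<longrightarrow> trig_dvd d g)"

text \<open>
  A greatest common divisor is unique only up to the units of this ring, the nonzero multiples of
  the exponentials; that it is constant means that some constant is one. This constant is
  nonzero, because it divides \<open>\<tau>2\<close>.

  The rational trigonometric polynomial \<open>\<tau>1 / \<tau>2\<close> is defined where \<open>\<tau>2\<close> does not vanish;
  \<open>\<tau>\<close> is unconstrained elsewhere.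
\<close>

definition rational_trig_poly ::
  "(real ^ 'n \<Rightarrow> complex) \<Rightarrow> (real ^ 'n \<Rightarrow> complex) \<Rightarrow> (real ^ 'n \<Rightarrow> complex) \<Rightarrow> bool" where
  "rational_trig_poly \<tau> \<tau>1 \<tau>2 \<longleftrightarrow>
     trig_poly \<tau>1 \<and> trig_poly \<tau>2 \<and> (\<exists>\<xi>. \<tau>2 \<xi> \<noteq> 0) \<and>
     (\<exists>c. is_trig_gcd (\<lambda>\<xi>. c) \<tau>1 \<tau>2) \<and>
     (\<forall>\<xi>. \<tau>2 \<xi> \<noteq> 0 \<longrightarrow> \<tau> \<xi> = \<tau>1 \<xi> / \<tau>2 \<xi>)"

end

theory Submission
  imports Defs
begin

text \<open>
  Near \<open>0\<close> the quotient \<open>\<tau>\<close> is differentiable, so \<open>norm (\<tau> \<xi> - 1) \<le> C * norm \<xi>\<close>. Along the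
  contracting points \<open>\<lambda>\<^sup>-\<^sup>j \<xi>\<close> these deviations are dominated by a geometric series with sum
  \<open>C * norm \<xi>\<close>, so the product converges absolutely and differs from \<open>1\<close> by at most
  \<open>exp (C * norm \<xi>) - 1\<close>.
\<close>

lemma trig_poly_differentiable:
  assumes "trig_poly f"
  shows "f differentiable (at x)"
proof -
  obtain K :: "(int ^ 'a) set" and h where "finite K" and
    f: "f = (\<lambda>\<xi>. \<Sum>k\<in>K. h k * exp (- (\<i> * of_real ((\<chi> i. real_of_int (k $ i)) \<bullet> \<xi>))))"
    using assms unfolding trig_poly_def by blast
  \<comment> \<open>One exponential suffices. The complex derivative of \<open>exp\<close> is in
    particular a real-linear one, and the exponent is a bounded real-linear map of
    \<open>\<xi>\<close>.\<close>
  have "(\<lambda>\<xi>. exp (- (\<i> * of_real (v \<bullet> \<xi>)))) differentiable (at x)" for v :: "real ^ 'a"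
  proof (rule differentiable_compose[of exp])
    show "exp differentiable at (- (\<i> * complex_of_real (v \<bullet> x)))"
      using DERIV_exp by (auto simp: differentiable_def has_field_derivative_def)
    have "bounded_linear (\<lambda>\<xi>. - (\<i> * complex_of_real (v \<bullet> \<xi>)))"
      by (intro bounded_linear_minus bounded_linear_const_mult
          bounded_linear_compose[OF bounded_linear_of_real] bounded_linear_inner_right)
    then show "(\<lambda>\<xi>. - (\<i> * complex_of_real (v \<bullet> \<xi>))) differentiable at x"
      by (rule bounded_linear_imp_differentiable)
  qed
  with \<open>finite K\<close> show ?thesis
    unfolding f by (intro differentiable_sum ballI differentiable_mult differentiable_const)
qed

text \<open>The derivative contributes a slope of at most its bound \<open>K\<close>, and close to
  \<open>x\<close> the remainder contributes at most 1 more, whence \<open>K + 1\<close>. One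
  endpoint stays fixed at \<open>x\<close>, so this is weaker than a local Lipschitz
  condition.\<close>

lemma differentiable_imp_locally_bounded_slope:
  fixes f :: "'a::real_normed_vector \<Rightarrow> 'b::real_normed_vector"
  assumes "f differentiable (at x)"
  obtains C d where "C \<ge> 0" "d > 0"
    "\<And>y. norm (y - x) < d \<Longrightarrow> norm (f y - f x) \<le> C * norm (y - x)"
proof -
  obtain f' where f': "(f has_derivative f') (at x)"
    using assms unfolding differentiable_def by blast
  then have "bounded_linear f'"
    by (rule has_derivative_bounded_linear)
  then obtain K where K: "K \<ge> 0" "\<And>h. norm (f' h) \<le> norm h * K"
    using bounded_linear.nonneg_bounded by blast
  obtain d where d: "d > 0"
    "\<And>y. norm (y - x) < d \<Longrightarrow> norm (f y - f x - f' (y - x)) \<le> 1 * norm (y - x)"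
    using f' unfolding has_derivative_at_alt by (meson zero_less_one)
  have "norm (f y - f x) \<le> (K + 1) * norm (y - x)" if "norm (y - x) < d" for y
    using norm_triangle_sub[of "f y - f x" "f' (y - x)"] d(2)[OF that] K(2)[of "y - x"]
    by (simp add: algebra_simps)
  with K(1) d(1) show thesis
    by (intro that[of "K + 1" d]) auto
qed

text \<open>Expanding a partial product of factors 1 + a_i and removing the term 1 leaves products
  of the a_i; replacing each a_i by its norm can only enlarge the result. Then 1 + t \<le> exp t
  gives a bound independent of \<open>n\<close>, which survives the limit.\<close>

lemma norm_prodinf_minus_1_le:
  fixes f :: "nat \<Rightarrow> 'a :: {real_normed_field,banach}"
  assumes "summable (\<lambda>n. norm (f n - 1))"
  shows "norm (prodinf f - 1) \<le> exp (\<Sum>n. norm (f n - 1)) - 1"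
proof (rule LIMSEQ_le_const2)
  have "convergent_prod f"
    using assms by (intro abs_convergent_prod_imp_convergent_prod summable_imp_abs_convergent_prod)
  then show "(\<lambda>n. norm (prod f {..n} - 1)) \<longlonglongrightarrow> norm (prodinf f - 1)"
    by (intro tendsto_intros convergent_prod_LIMSEQ)
  have "norm (prod f {..n} - 1) \<le> exp (\<Sum>n. norm (f n - 1)) - 1" for n
  proof -
    have "norm (prod f {..n} - 1) \<le> (\<Prod>i\<le>n. 1 + norm (f i - 1)) - 1"
      using norm_prod_minus1_le_prod_minus1[of "\<lambda>n. f n - 1" "{..n}"] by simp
    also have "(\<Prod>i\<le>n. 1 + norm (f i - 1)) \<le> exp (\<Sum>i\<le>n. norm (f i - 1))"
      by (intro prod_le_exp_sum) auto
    also have "\<dots> \<le> exp (\<Sum>n. norm (f n - 1))"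
      using assms by (simp add: sum_le_suminf)
    finally show ?thesis by simp
  qed
  then show "\<exists>N. \<forall>n\<ge>N. norm (prod f {..n} - 1) \<le> exp (\<Sum>n. norm (f n - 1)) - 1"
    by blast
qed

lemma prodinf_dilates_bound:
  fixes f :: "'a::real_normed_vector \<Rightarrow> 'b :: {real_normed_field,banach}"
  assumes "r \<ge> 2" and "C \<ge> 0"
    and bound: "\<And>y. norm y < d \<Longrightarrow> norm (f y - 1) \<le> C * norm y"
    and x: "norm x < d"
  shows "convergent_prod (\<lambda>j. f ((1 / r ^ Suc j) *\<^sub>R x))" (is "convergent_prod ?g")
    and "norm ((\<Prod>j. f ((1 / r ^ Suc j) *\<^sub>R x)) - 1) \<le> exp (C * norm x) - 1"
proof -
  have le: "norm (?g j - 1) \<le> C * norm x * (1 / 2) ^ Suc j" for j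
  proof -
    have "1 / r ^ Suc j \<le> (1 / 2) ^ Suc j"
      using \<open>r \<ge> 2\<close> by (simp only: power_one_over) (intro divide_left_mono power_mono; simp)
    then have y: "norm ((1 / r ^ Suc j) *\<^sub>R x) \<le> (1 / 2) ^ Suc j * norm x"
      using \<open>r \<ge> 2\<close> by (simp only: norm_scaleR) (intro mult_right_mono; simp)
    \<comment> \<open>This cruder estimate only keeps the dilated point within radius
      \<open>d\<close>, where \<open>bound\<close> applies; the decay in \<open>j\<close> comes from
      \<open>y\<close> itself.\<close>
    also have "\<dots> \<le> norm x"
      by (rule mult_left_le_one_le) (auto intro: power_le_one simp del: power_Suc)
    finally have "norm (?g j - 1) \<le> C * norm ((1 / r ^ Suc j) *\<^sub>R x)"
      using x by (intro bound) simp
    also have "\<dots> \<le> C * ((1 / 2) ^ Suc j * norm x)"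
      by (intro mult_left_mono y \<open>C \<ge> 0\<close>)
    finally show ?thesis by (simp only: mult_ac)
  qed
  \<comment> \<open>The exponents start at 1, so the geometric series adds up to exactly 1 and no
    extra constant enters.\<close>
  have sums: "(\<lambda>j. C * norm x * (1 / 2) ^ Suc j) sums (C * norm x * 1)"
    by (intro sums_mult power_half_series)
  have summable: "summable (\<lambda>j. norm (?g j - 1))"
    by (rule summable_comparison_test'[OF sums_summable[OF sums], of 0]) (use le in simp)
  then show "convergent_prod ?g"
    by (intro abs_convergent_prod_imp_convergent_prod summable_imp_abs_convergent_prod)
  have "(\<Sum>j. norm (?g j - 1)) \<le> C * norm x"
    using suminf_le[OF le summable sums_summable[OF sums]] sums_unique[OF sums] by simp
  then have "exp (\<Sum>j. norm (?g j - 1)) \<le> exp (C * norm x)"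
    by simp
  with norm_prodinf_minus_1_le[OF summable]
  show "norm (prodinf ?g - 1) \<le> exp (C * norm x) - 1"
    by linarith
qed

theorem proposition4p2:
  fixes \<tau> \<tau>1 \<tau>2 :: "real ^ 'n \<Rightarrow> complex" and l :: int
  assumes "l \<ge> 2"
    and "rational_trig_poly \<tau> \<tau>1 \<tau>2"
    and "\<tau>2 0 \<noteq> 0"
    and "\<tau> 0 = 1"
  shows "(\<forall>\<^sub>F \<xi> in at 0.
            (\<forall>j\<ge>1. \<tau>2 ((1 / real_of_int l ^ j) *\<^sub>R \<xi>) \<noteq> 0) \<and>
            convergent_prod (\<lambda>j. \<tau> ((1 / real_of_int l ^ Suc j) *\<^sub>R \<xi>))) \<and>
         ((\<lambda>\<xi>. \<Prod>j. \<tau> ((1 / real_of_int l ^ Suc j) *\<^sub>R \<xi>)) \<longlongrightarrow> 1) (at 0)"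
proof -
  have \<tau>1: "trig_poly \<tau>1" and \<tau>2: "trig_poly \<tau>2"
    and \<tau>: "\<And>\<xi>. \<tau>2 \<xi> \<noteq> 0 \<Longrightarrow> \<tau> \<xi> = \<tau>1 \<xi> / \<tau>2 \<xi>"
    using assms(2) unfolding rational_trig_poly_def by blast+
  \<comment> \<open>\<open>\<tau>\<close> is tied to the quotient only where \<open>\<tau>2\<close>
    is nonzero, so a whole ball free of zeros is needed before differentiability can pass from the
    quotient to \<open>\<tau>\<close>.\<close>
  have "isCont \<tau>2 0"
    using trig_poly_differentiable[OF \<tau>2] by (rule differentiable_imp_continuous_within)
  then obtain d2 where "d2 > 0" and d2: "\<And>y. dist y 0 < d2 \<Longrightarrow> \<tau>2 y \<noteq> 0"
    using continuous_at_avoid[of 0 \<tau>2 0] \<open>\<tau>2 0 \<noteq> 0\<close> by (metis dist_commute)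
  have "(\<lambda>\<xi>. \<tau>1 \<xi> / \<tau>2 \<xi>) differentiable (at 0)"
    using \<tau>1 \<tau>2 \<open>\<tau>2 0 \<noteq> 0\<close> by (intro differentiable_divide trig_poly_differentiable)
  then have "\<tau> differentiable (at 0)"
    by (rule differentiable_transform_within[OF _ \<open>d2 > 0\<close>]) (auto simp: \<tau> d2)
  then obtain C d1 where "C \<ge> 0" "d1 > 0"
    and d1: "\<And>y. norm y < d1 \<Longrightarrow> norm (\<tau> y - 1) \<le> C * norm y"
    using differentiable_imp_locally_bounded_slope[of \<tau> 0] \<open>\<tau> 0 = 1\<close> by (metis diff_zero)
  have l: "real_of_int l \<ge> 2"
    using \<open>l \<ge> 2\<close> by simp
  have "\<forall>\<^sub>F \<xi> in at (0 :: real ^ 'n). dist \<xi> 0 < min d1 d2"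
    using \<open>d1 > 0\<close> \<open>d2 > 0\<close> unfolding eventually_at by (intro exI[of _ "min d1 d2"]) auto
  then have small: "\<forall>\<^sub>F \<xi> in at (0 :: real ^ 'n). norm \<xi> < d1 \<and> norm \<xi> < d2"
    by simp
  \<comment> \<open>The dilations do not increase the norm, so the single radius \<open>d2\<close>
    serves all \<open>j\<close> at once.\<close>
  have ne: "\<tau>2 ((1 / real_of_int l ^ j) *\<^sub>R \<xi>) \<noteq> 0" if "norm \<xi> < d2" for \<xi> j
  proof (rule d2)
    have "norm ((1 / real_of_int l ^ j) *\<^sub>R \<xi>) \<le> norm \<xi>"
      using l by (simp add: divide_le_eq mult_left_le_one_le mult_le_cancel_left1)
    with that show "dist ((1 / real_of_int l ^ j) *\<^sub>R \<xi>) 0 < d2"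
      by simp
  qed
  have "\<forall>\<^sub>F \<xi> in at 0.
          (\<forall>j\<ge>1. \<tau>2 ((1 / real_of_int l ^ j) *\<^sub>R \<xi>) \<noteq> 0) \<and>
          convergent_prod (\<lambda>j. \<tau> ((1 / real_of_int l ^ Suc j) *\<^sub>R \<xi>))"
    using small by eventually_elim
      (use ne prodinf_dilates_bound(1)[OF l \<open>C \<ge> 0\<close> d1] in blast)
  moreover have "((\<lambda>\<xi>. (\<Prod>j. \<tau> ((1 / real_of_int l ^ Suc j) *\<^sub>R \<xi>)) - 1) \<longlongrightarrow> 0) (at 0)"
  \<comment> \<open>Squeeze: the majorant \<open>exp (C * norm \<xi>) - 1\<close> is continuous and
    vanishes at the origin.\<close>
  proof (rule Lim_null_comparison)
    show "\<forall>\<^sub>F \<xi> in at 0. norm ((\<Prod>j. \<tau> ((1 / real_of_int l ^ Suc j) *\<^sub>R \<xi>)) - 1)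
            \<le> exp (C * norm \<xi>) - 1"
      using small by eventually_elim
        (use prodinf_dilates_bound(2)[OF l \<open>C \<ge> 0\<close> d1] in blast)
    have "((\<lambda>\<xi> :: real ^ 'n. exp (C * norm \<xi>) - 1) \<longlongrightarrow> exp (C * norm (0 :: real ^ 'n)) - 1) (at 0)"
      by (intro tendsto_intros)
    then show "((\<lambda>\<xi> :: real ^ 'n. exp (C * norm \<xi>) - 1) \<longlongrightarrow> 0) (at 0)"
      by simp
  qed
  ultimately show ?thesis
    using Lim_null by blast
qed

end
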